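(* Let $p<q$ be prime numbers and $N=pq$. If $(\mathbb{Q}\setminus\mathbb{Z})\text{-}\mathcal{KS}(N)=\emptyset$, then $\mathbb{Z}\text{-}\mathcal{KS}(N)=\{q+p-1\}$.
   Context: For a rational number $\alpha\neq 0$ write $\alpha=\frac{\alpha_1}{\alpha_2}$ with $\alpha_1,\alpha_2$ integers and $\gcd(\alpha_1,\alpha_2)=1$. An integer $N\ge 2$ is called an $\alpha$-Korselt number if $N\neq\alpha$ and $\alpha_2 r-\alpha_1$ divides $\alpha_2 N-\alpha_1$ (in $\mathbb{Z}$; $0$ divides only $0$) for every prime divisor $r$ of $N$. For a subset $\mathbb{A}\subseteq\mathbb{Q}$, $\mathbb{A}\text{-}\mathcal{KS}(N)$ denotes the set of all $\beta\in\mathbb{A}\setminus\{0,N\}$ such that $N$ is a $\beta$-Korselt number (such $\beta$ are called $N$-Korselt bases). *)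

theory Defs
  imports Complex_Main "HOL-Computational_Algebra.Primes"
begin

text \<open>
  \<open>quotient_of \<alpha>\<close> is the reduced fraction \<open>(\<alpha>\<^sub>1, \<alpha>\<^sub>2)\<close> with positive denominator; changing the
  sign of both entries would not affect the divisibilities below.
\<close>

definition Korselt_number :: "rat \<Rightarrow> int \<Rightarrow> bool" where
  "Korselt_number \<alpha> N \<longleftrightarrow>
     \<alpha> \<noteq> 0 \<and> N \<ge> 2 \<and> of_int N \<noteq> \<alpha> \<and>
     (case quotient_of \<alpha> of (\<alpha>\<^sub>1, \<alpha>\<^sub>2) \<Rightarrow>
        (\<forall>r. prime r \<and> r dvd N \<longrightarrow> \<alpha>\<^sub>2 * r - \<alpha>\<^sub>1 dvd \<alpha>\<^sub>2 * N - \<alpha>\<^sub>1))"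

definition Korselt_set :: "rat set \<Rightarrow> int \<Rightarrow> rat set" where
  "Korselt_set A N = {\<beta> \<in> A - {0, of_int N}. Korselt_number \<beta> N}"

end

theory Submission
  imports Defs
begin

text \<open>
  If an integer \<open>a\<close> is a Korselt base of \<open>N = p q\<close>, then so is the rational number
  \<open>\<alpha>' = N (p + q - 1 - a) / (N - a)\<close>, provided it is nonzero, that is, \<open>a \<noteq> p + q - 1\<close>.
  This conjugate base arises from replacing the divisors \<open>p - a\<close> of \<open>p (q - 1)\<close> and \<open>q - a\<close> of
  \<open>q (p - 1)\<close> by their cofactors. A Korselt base \<open>a\<close> is not a multiple of \<open>q\<close>, so
  \<open>q - a\<close> divides \<open>p - 1\<close>, which confines \<open>a\<close> to \<open>q - p + 1 \<le> a \<le> q + p - 1\<close>; for \<open>a\<close> in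
  this range other than \<open>q + p - 1\<close>, even after cancelling its common factor with \<open>N\<close>, the
  denominator \<open>N - a\<close> exceeds \<open>p + q - 1 - a > 0\<close>, so \<open>\<alpha>'\<close> is not an integer.
\<close>

text \<open>A common factor of \<open>x\<close> and \<open>y\<close> scales both sides of each
  divisibility alike, so the fraction need not be reduced. The conjugate base is in general not
  given in lowest terms.\<close>

lemma Korselt_number_divide_iff:
  fixes x y N :: int
  assumes "y \<noteq> 0"
  shows "Korselt_number (of_int x / of_int y) N \<longleftrightarrow>
    x \<noteq> 0 \<and> N \<ge> 2 \<and> x \<noteq> y * N \<and>
    (\<forall>r. prime r \<and> r dvd N \<longrightarrow> y * r - x dvd y * N - x)"
proof -
  obtain m n where mn: "quotient_of (of_int x / of_int y) = (m, n)"
    by (cases "quotient_of (of_int x / of_int y)") auto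
  have n: "n > 0" and cop: "coprime m n"
    using quotient_of_denom_pos[OF mn] quotient_of_coprime[OF mn] by auto
  have "(of_int x / of_int y :: rat) = of_int m / of_int n"
    using quotient_of_div[OF mn] .
  then have "(of_int (x * n) :: rat) = of_int (m * y)"
    using n assms by (simp add: field_simps)
  then have xn: "x * n = m * y"
    by (simp only: of_int_eq_iff)
  then have "n dvd m * y"
    by (metis dvd_triv_right)
  then have "n dvd y"
    using cop by (simp add: coprime_commute coprime_dvd_mult_right_iff)
  then obtain g where y: "y = n * g" ..
  have x: "x = m * g"
    using xn n y by simp
  have g: "g \<noteq> 0"
    using assms y by auto
  have "y * r - x dvd y * N - x \<longleftrightarrow> n * r - m dvd n * N - m" for r
  proof -
    have "y * r - x = g * (n * r - m)" "y * N - x = g * (n * N - m)"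
      by (simp_all add: x y algebra_simps)
    then show ?thesis
      using g by simp
  qed
  moreover have "(of_int N \<noteq> (of_int x / of_int y :: rat)) \<longleftrightarrow> x \<noteq> y * N"
  proof -
    have "of_int N = (of_int x / of_int y :: rat) \<longleftrightarrow> of_int (y * N) = (of_int x :: rat)"
      using assms by (simp add: field_simps)
    then show ?thesis
      by (auto simp only: of_int_eq_iff)
  qed
  ultimately show ?thesis
    using assms by (auto simp: Korselt_number_def mn)
qed

lemma Korselt_number_prime_mult_divide_iff:
  fixes p q x y :: int
  assumes "prime p" "prime q" "y \<noteq> 0"
  shows "Korselt_number (of_int x / of_int y) (p * q) \<longleftrightarrow>
    x \<noteq> 0 \<and> x \<noteq> y * (p * q) \<and>
    y * p - x dvd y * (p * q) - x \<and> y * q - x dvd y * (p * q) - x"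
proof -
  have "prime r \<and> r dvd p * q \<longleftrightarrow> r = p \<or> r = q" for r
    using assms(1,2) by (auto simp: prime_dvd_mult_iff dest: primes_dvd_imp_eq)
  moreover have "p * q \<ge> 2"
    using mult_mono[of 2 p 1 q] prime_ge_2_int[OF assms(1)] prime_ge_2_int[OF assms(2)] by simp
  ultimately show ?thesis
    by (auto simp: Korselt_number_divide_iff[OF assms(3)])
qed

lemma of_int_divide_in_Ints_imp_dvd:
  fixes x y :: int
  assumes "y \<noteq> 0" "(of_int x / of_int y :: rat) \<in> \<int>"
  shows "y dvd x"
proof -
  obtain k where "(of_int x / of_int y :: rat) = of_int k"
    using assms(2) by (rule Ints_cases)
  then have "(of_int x :: rat) = of_int (y * k)"
    using assms(1) by (simp add: field_simps)
  then show ?thesis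
    by (simp only: of_int_eq_iff dvd_triv_left)
qed

text \<open>Since \<open>p * q - a = p * (q - 1) + (p - a)\<close>, \<open>dvd_p\<close> is the
  Korselt condition at \<open>p\<close>; \<open>dvd_q\<close> is likewise the one at
  \<open>q\<close>.\<close>

locale integer_Korselt_base =
  fixes p q a :: int
  assumes prime_p: "prime p" and prime_q: "prime q" and less: "p < q"
    and nonzero: "a \<noteq> 0" and neq_prod: "a \<noteq> p * q"
    and dvd_p: "p - a dvd p * (q - 1)" and dvd_q: "q - a dvd q * (p - 1)"
begin

lemma p_ge_2: "p \<ge> 2"
  using prime_ge_2_int[OF prime_p] .

lemma a_neq_p: "a \<noteq> p"
  using dvd_p p_ge_2 less by auto

text \<open>If \<open>a = q * k\<close>, then removing \<open>p\<close> from \<open>dvd_p\<close>,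
  by cancellation or by coprimality, leaves a divisor of \<open>q - 1\<close> that is too large in
  absolute value.\<close>

lemma not_q_dvd: "\<not> q dvd a"
proof
  assume "q dvd a"
  then obtain k where k: "a = q * k" ..
  show False
  proof (cases "p dvd k")
    case True
    then obtain l where l: "k = p * l" ..
    have "p * (1 - q * l) dvd p * (q - 1)"
      using dvd_p by (simp add: k l algebra_simps)
    then have "1 - q * l dvd q - 1"
      using p_ge_2 by simp
    then have bound: "\<bar>1 - q * l\<bar> \<le> q - 1"
      using dvd_imp_le_int[of "q - 1" "1 - q * l"] p_ge_2 less by auto
    \<comment> \<open>These values would give \<open>a = 0\<close> and
      \<open>a = p * q\<close>.\<close>
    have "l \<noteq> 0" "l \<noteq> 1"
      using nonzero neq_prod k l by auto
    then consider "l \<le> -1" | "l \<ge> 2"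
      by linarith
    then show False
    proof cases
      case 1
      then have "q * l \<le> q * (-1)"
        using p_ge_2 less by (intro mult_left_mono) auto
      then show False
        using bound by linarith
    next
      case 2
      then have "q * l \<ge> q * 2"
        using p_ge_2 less by (intro mult_left_mono) auto
      then show False
        using bound p_ge_2 less by linarith
    qed
  next
    case False
    have "\<not> p dvd q"
      using primes_dvd_imp_eq[OF prime_p prime_q] less by auto
    then have "\<not> p dvd p - a"
      using False by (simp add: k prime_dvd_mult_iff[OF prime_p] dvd_diff_right_iff)
    then have "coprime (p - a) p"
      using prime_imp_coprime[OF prime_p] coprime_commute by blast
    then have "p - a dvd q - 1"
      using dvd_p by (simp add: coprime_dvd_mult_right_iff)
    then have bound: "\<bar>p - q * k\<bar> \<le> q - 1"
      using dvd_imp_le_int[of "q - 1" "p - a"] p_ge_2 less by (auto simp: k)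
    \<comment> \<open>For \<open>k = 1\<close> the divisor \<open>q - a\<close> in
      \<open>dvd_q\<close> would be \<open>0\<close>, but \<open>q * (p - 1)\<close> is not.\<close>
    have "k \<noteq> 0" "k \<noteq> 1"
      using nonzero dvd_q p_ge_2 less by (auto simp: k)
    then consider "k \<le> -1" | "k \<ge> 2"
      by linarith
    then show False
    proof cases
      case 1
      then have "q * k \<le> q * (-1)"
        using p_ge_2 less by (intro mult_left_mono) auto
      then show False
        using bound p_ge_2 by linarith
    next
      case 2
      then have "q * k \<ge> q * 2"
        using p_ge_2 less by (intro mult_left_mono) auto
      then show False
        using bound p_ge_2 less by linarith
    qed
  qed
qed

lemma abs_q_minus_a_le: "\<bar>q - a\<bar> \<le> p - 1"
proof -
  have "\<not> q dvd q - a"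
    using not_q_dvd by (simp add: dvd_diff_right_iff)
  then have "coprime (q - a) q"
    using prime_imp_coprime[OF prime_q] coprime_commute by blast
  then have "q - a dvd p - 1"
    using dvd_q by (simp add: coprime_dvd_mult_right_iff)
  then show ?thesis
    using dvd_imp_le_int[of "p - 1" "q - a"] p_ge_2 by auto
qed

lemma conjugate_base_not_integral:
  assumes "a \<noteq> q + p - 1"
  shows "\<not> p * q - a dvd p * q * (p + q - 1 - a)"
proof
  assume dvd: "p * q - a dvd p * q * (p + q - 1 - a)"
  have c: "p + q - 1 - a > 0"
    using abs_q_minus_a_le assms by linarith
  show False
  proof (cases "p dvd a")
    case True
    then obtain k where k: "a = p * k" ..
    have "a > 0"
      using abs_q_minus_a_le less by linarith
    then have "k \<ge> 2"
      using a_neq_p p_ge_2 by (auto simp: k zero_less_mult_iff intro: ccontr)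
    \<comment> \<open>The gap between \<open>q - k\<close> and \<open>p + q - 1 - a\<close> is
      \<open>(p - 1) * (k - 1)\<close>, which is positive because \<open>a \<noteq> p\<close> forced
      \<open>k \<ge> 2\<close>.\<close>
    then have "(p - 1) * k \<ge> (p - 1) * 2"
      using p_ge_2 by (intro mult_left_mono) auto
    then have less_c: "q - k > p + q - 1 - a"
      using p_ge_2 by (simp add: k algebra_simps)
    have "p * (q - k) dvd p * (q * (p + q - 1 - a))"
      using dvd by (simp add: k algebra_simps)
    then have "q - k dvd q * (p + q - 1 - a)"
      using p_ge_2 by simp
    moreover have "\<not> q dvd q - k"
      using not_q_dvd by (auto simp: k dvd_diff_right_iff)
    then have "coprime (q - k) q"
      using prime_imp_coprime[OF prime_q] coprime_commute by blast
    ultimately have "q - k dvd p + q - 1 - a"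
      by (simp add: coprime_dvd_mult_right_iff)
    then show False
      using zdvd_imp_le[of "q - k" "p + q - 1 - a"] c less_c by linarith
  next
    case False
    have "\<not> p dvd p * q - a" "\<not> q dvd p * q - a"
      using False not_q_dvd by (simp_all add: dvd_diff_right_iff)
    then have "coprime (p * q - a) (p * q)"
      using prime_imp_coprime[OF prime_p] prime_imp_coprime[OF prime_q] coprime_commute
      by (metis coprime_mult_right_iff)
    then have "p * q - a dvd p + q - 1 - a"
      using dvd by (simp add: coprime_dvd_mult_right_iff)
    then have "p * q - a \<le> p + q - 1 - a"
      using zdvd_imp_le c by blast
    \<comment> \<open>This product is \<open>(p * q - a) - (p + q - 1 - a)\<close>.\<close>
    moreover have "(p - 1) * (q - 1) > 0"
      using p_ge_2 less by simp
    ultimately show False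
      by (simp add: algebra_simps)
  qed
qed

lemma Korselt_number_conjugate_base:
  assumes "a \<noteq> q + p - 1"
  shows "Korselt_number (of_int (p * q * (p + q - 1 - a)) / of_int (p * q - a)) (p * q)"
proof -
  let ?x = "p * q * (p + q - 1 - a)" and ?y = "p * q - a"
  \<comment> \<open>With \<open>A = p * (q - 1)\<close> and \<open>B = q * (p - 1)\<close>, the
    right-hand side of both divisibilities is \<open>A * B\<close>, while the divisors are
    \<open>- A * (q - a)\<close> and \<open>- (p - a) * B\<close>.\<close>
  have yN: "?y * (p * q) - ?x = p * (q - 1) * (q * (p - 1))"
    by (simp add: algebra_simps)
  have "?y * p - ?x = p * (q - 1) * (- (q - a))"
    by (simp add: algebra_simps)
  moreover have "p * (q - 1) * (- (q - a)) dvd p * (q - 1) * (q * (p - 1))"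
    using dvd_q by (intro mult_dvd_mono) (simp_all only: dvd_refl minus_dvd_iff)
  moreover have "?y * q - ?x = (- (p - a)) * (q * (p - 1))"
    by (simp add: algebra_simps)
  moreover have "(- (p - a)) * (q * (p - 1)) dvd p * (q - 1) * (q * (p - 1))"
    using dvd_p by (intro mult_dvd_mono) (simp_all only: dvd_refl minus_dvd_iff)
  ultimately have "?y * p - ?x dvd ?y * (p * q) - ?x" "?y * q - ?x dvd ?y * (p * q) - ?x"
    by (simp_all only: yN)
  moreover have "?y \<noteq> 0"
    using neq_prod by simp
  \<comment> \<open>Non-integrality excludes both degenerate values, since \<open>?y\<close> divides
    \<open>0\<close> and \<open>?y * (p * q)\<close>.\<close>
  moreover have "?x \<noteq> 0"
    using conjugate_base_not_integral[OF assms] by auto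
  moreover have "?x \<noteq> ?y * (p * q)"
    using conjugate_base_not_integral[OF assms] by (metis dvd_triv_left)
  ultimately show ?thesis
    using Korselt_number_prime_mult_divide_iff[OF prime_p prime_q] by blast
qed

end

lemma Korselt_number_of_int_iff:
  fixes p q a :: int
  assumes "prime p" "prime q"
  shows "Korselt_number (of_int a) (p * q) \<longleftrightarrow>
    a \<noteq> 0 \<and> a \<noteq> p * q \<and> p - a dvd p * (q - 1) \<and> q - a dvd q * (p - 1)"
proof -
  have "p * q - a = p * (q - 1) + (p - a)" "p * q - a = q * (p - 1) + (q - a)"
    by (simp_all add: algebra_simps)
  then have "p - a dvd p * q - a \<longleftrightarrow> p - a dvd p * (q - 1)"
    "q - a dvd p * q - a \<longleftrightarrow> q - a dvd q * (p - 1)"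
    by (metis dvd_add_left_iff dvd_refl)+
  then show ?thesis
    using Korselt_number_prime_mult_divide_iff[OF assms, of 1 a] by simp
qed

theorem mainTheorem1:
  fixes p q N :: int
  assumes "prime p" and "prime q" and "p < q" and "N = p * q"
    and "Korselt_set (UNIV - \<int>) N = {}"
  shows "Korselt_set \<int> N = {of_int (q + p - 1)}"
proof
  show "Korselt_set \<int> N \<subseteq> {of_int (q + p - 1)}"
  proof
    fix \<beta> assume \<beta>: "\<beta> \<in> Korselt_set \<int> N"
    then obtain a where a: "\<beta> = of_int a"
      by (auto simp: Korselt_set_def elim: Ints_cases)
    have "Korselt_number (of_int a) (p * q)"
      using \<beta> assms(4) by (simp add: Korselt_set_def a)
    then interpret integer_Korselt_base p q a
      using assms(1-3) by unfold_locales (simp_all add: Korselt_number_of_int_iff)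
    show "\<beta> \<in> {of_int (q + p - 1)}"
    proof (rule ccontr)
      assume "\<beta> \<notin> {of_int (q + p - 1)}"
      then have ne: "a \<noteq> q + p - 1"
        by (auto simp: a)
      \<comment> \<open>The conjugate base of \<open>a\<close> is a non-integral Korselt base,
        contradicting the assumed emptiness.\<close>
      define \<alpha> :: rat where "\<alpha> = of_int (p * q * (p + q - 1 - a)) / of_int (p * q - a)"
      have "\<alpha> \<notin> \<int>"
        using of_int_divide_in_Ints_imp_dvd[of "p * q - a"] conjugate_base_not_integral[OF ne] neq_prod
        unfolding \<alpha>_def by (metis eq_iff_diff_eq_0)
      moreover have "Korselt_number \<alpha> N"
        using Korselt_number_conjugate_base[OF ne] by (simp only: \<alpha>_def assms(4))
      ultimately have "\<alpha> \<in> Korselt_set (UNIV - \<int>) N"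
        by (auto simp: Korselt_set_def)
      then show False
        using assms(5) by simp
    qed
  qed
next
  have pq: "p \<ge> 2" "q \<ge> 2"
    using assms(1,2) by (auto intro: prime_ge_2_int)
  \<comment> \<open>This is \<open>p * q - (q + p - 1)\<close>, so the claimed base differs from
    \<open>N\<close>.\<close>
  then have "(p - 1) * (q - 1) > 0"
    by simp
  then have ne: "q + p - 1 \<noteq> p * q"
    by (simp add: algebra_simps)
  \<comment> \<open>Up to sign, these differences are factors of \<open>p * (q - 1)\<close> and
    \<open>q * (p - 1)\<close>, as the Korselt conditions demand.\<close>
  moreover have "p - (q + p - 1) = - (q - 1)" "q - (q + p - 1) = - (p - 1)"
    by simp_all
  ultimately have "Korselt_number (of_int (q + p - 1)) N"
    using pq unfolding assms(4) Korselt_number_of_int_iff[OF assms(1,2)]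
    by (simp only: minus_dvd_iff dvd_triv_right) auto
  then show "{of_int (q + p - 1)} \<subseteq> Korselt_set \<int> N"
    by (auto simp only: Korselt_set_def Korselt_number_def Ints_of_int)
qed

end
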